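(* For $2 \leq i \leq 4$, $O(c_i) = O(a_i) = \prod_{j=1}^{i} N_j$. For every integer $i \geq 5$, both $O(c_i)$ and $O(a_i)$ are at least $\prod_{j=1}^{4} N_j \cdot \prod_{j=5}^{i} (2^{j+2}+1)$.
   Context: Conway's tower of finite fields of characteristic two: $c_{-1} = 1$, $L_{-1} = F_2(c_{-1}) = F_2$ (the field with 2 elements); for $i \geq -1$, $L_{i+1} = L_i(c_{i+1})$, where $c_{i+1}$ satisfies $c_{i+1}^2 + c_{i+1} + \prod_{j=-1}^{i} c_j = 0$. Each $L_{i+1}$ is a quadratic extension of $L_i$, so for $i\ge 0$ the multiplicative group $L_i^* = L_i\setminus\{0\}$ has $2^{2^{i+1}}-1$ elements. Put $a_k = \prod_{j=0}^{k} c_j$ for $k \geq 0$, and let $N_j = 2^{2^j}+1$ ($j \geq 0$) be the Fermat numbers. $O(x)$ denotes the multiplicative order of a nonzero element $x$. *)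

theory Defs
  imports "HOL-Algebra.Generated_Fields"
begin

(* K is an arbitrary ambient field of characteristic two, with prime field {0, 1}. The integer
   indexing keeps the indices i >= -1 of the tower; the values of c and L below -1 are irrelevant. *)
locale conway_tower = field K for K :: "('a, 'b) ring_scheme" (structure) +
  fixes c :: "int \<Rightarrow> 'a" and L :: "int \<Rightarrow> 'a set"
  assumes char_two: "\<one> \<oplus> \<one> = \<zero>"
    and c_closed: "\<And>i. i \<ge> -1 \<Longrightarrow> c i \<in> carrier K"
    and c_base: "c (-1) = \<one>"
    and L_base: "L (-1) = generate_field K ({\<zero>, \<one>} \<union> {c (-1)})"
    and c_step: "\<And>i. i \<ge> -1 \<Longrightarrow>
      c (i + 1) [^] (2::nat) \<oplus> c (i + 1) \<oplus> (\<Otimes>j\<in>{-1..i}. c j) = \<zero>"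
    and L_step: "\<And>i. i \<ge> -1 \<Longrightarrow> L (i + 1) = generate_field K (L i \<union> {c (i + 1)})"

definition conway_a :: "('a, 'b) ring_scheme \<Rightarrow> (int \<Rightarrow> 'a) \<Rightarrow> int \<Rightarrow> 'a" where
  "conway_a K c k = (\<Otimes>\<^bsub>K\<^esub>j\<in>{0..k}. c j)"

definition fermat :: "nat \<Rightarrow> nat" where
  "fermat j = 2 ^ (2 ^ j) + 1"

(* Order in the multiplicative group of the subfield F of K. *)
definition mult_ord :: "('a, 'b) ring_scheme \<Rightarrow> 'a set \<Rightarrow> 'a \<Rightarrow> nat" where
  "mult_ord K F x = group.ord (mult_of (K\<lparr>carrier := F\<rparr>)) x"

end

(* Write q for 2^(2^i), so that N_i = q + 1. The q-power map sends c_i to c_i + 1 and fixes a_{i-1};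
   hence c_i has relative norm c_i^(q+1) = a_{i-1}, and a_i = a_{i-1} c_i has relative norm a_{i-1}^3.
   An element x not fixed by the q-power map whose norm is fixed has order O(x^(q+1)) * e for some
   divisor e > 1 of N_i. Since 3 divides no N_j with j >= 1, cubing keeps the order from a_1 on,
   so O(a_i) = O(a_{i-1}) * e and O(c_i) = O(a_{i-1}) * e'. Finally N_1, ..., N_4 are prime, and
   every prime factor of N_j with j >= 2 is congruent to 1 modulo 2^(j+2). *)
theory Submission
  imports Defs "HOL-Number_Theory.Pocklington"
begin

section \<open>Orders in a group and the norm exponent \<open>q + 1\<close>\<close>

text \<open>The factor is \<open>gcd (ord x) (q + 1)\<close>. Were it 1, \<open>x\<close> and its
  norm would have the same order, so \<open>ord x\<close> would divide \<open>q - 1\<close>.\<close>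

lemma (in group) ord_norm_factor:
  fixes q :: nat
  assumes x: "x \<in> carrier G"
    and norm: "(x [^] (q + 1)) [^] (q - 1) = \<one>"
    and nontrivial: "x [^] (q - 1) \<noteq> \<one>"
  obtains e where "e > 1" "e dvd q + 1" "ord x = ord (x [^] (q + 1)) * e"
proof
  let ?e = "gcd (ord x) (q + 1)"
  have div: "ord (x [^] (q + 1)) = ord x div ?e"
    using ord_pow_gen[OF x, of "q + 1"] by simp
  then show eq: "ord x = ord (x [^] (q + 1)) * ?e"
    by simp
  have "ord (x [^] (q + 1)) dvd q - 1"
    using pow_eq_id[of "x [^] (q + 1)"] norm x by blast
  moreover have "\<not> ord x dvd q - 1"
    using pow_eq_id[OF x] nontrivial by blast
  ultimately have "?e \<noteq> 1"
    using eq by (metis mult.right_neutral)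
  moreover have "?e > 0"
    by (intro gcd_pos_nat[THEN iffD2]) simp
  ultimately show "?e > 1"
    by linarith
  show "?e dvd q + 1"
    by simp
qed

section \<open>Divisors of Fermat numbers\<close>

text \<open>Lucas's sharpening of Euler's congruence: \<open>t\<close> has order exactly
  \<open>2 ^ (j + 2)\<close> modulo \<open>p\<close>, and this order divides
  \<open>p - 1\<close>.\<close>

lemma prime_dvd_fermat_cong:
  fixes p j :: nat
  assumes p: "prime p" and dvd: "p dvd fermat j" and j: "j \<ge> 2"
  shows "2 ^ (j + 2) dvd p - 1"
proof -
  obtain k where k: "j = Suc (Suc k)"
    using j by (metis add_2_eq_Suc le_Suc_ex)
  define u :: nat where "u = 2 ^ (2 ^ (j - 1))"
  define t where "t = u + 1"
  have u2: "u ^ 2 + 1 = fermat j"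
    by (simp add: u_def fermat_def k power_mult[symmetric] mult.commute)
  \<comment> \<open>A square root of \<open>2 * u\<close>, that is, of an odd power of 2 modulo \<open>p\<close>: it has twice the order of 2.\<close>
  have t2: "[t ^ 2 = 2 * u] (mod p)"
  proof -
    have "t ^ 2 = fermat j + 2 * u"
      unfolding u2[symmetric] t_def by (simp add: power2_eq_square)
    then show ?thesis
      using dvd by (simp add: cong_def mod_add_left_eq[symmetric, of "fermat j"])
  qed
  have minus1: "[int (2 ^ (2 ^ j)) = -1] (mod int p)"
  proof -
    have "int p dvd int (2 ^ (2 ^ j) + 1)"
      using dvd unfolding fermat_def of_nat_dvd_iff .
    then show ?thesis
      by (simp add: cong_iff_dvd_diff add.commute)
  qed
  have pow: "(2 * u) ^ (2 ^ j) = (2 ^ (2 ^ j)) ^ (2 ^ (j - 1) + 1)"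
    by (simp add: u_def power_mult_distrib power_mult[symmetric] mult.commute power_add algebra_simps)
  have "[int (t ^ 2) = int (2 * u)] (mod int p)"
    using t2 by (simp only: cong_int_iff)
  then have "[int (t ^ 2) ^ (2 ^ j) = int (2 * u) ^ (2 ^ j)] (mod int p)"
    by (rule cong_pow)
  also have "int (2 * u) ^ (2 ^ j) = int (2 ^ (2 ^ j)) ^ (2 ^ (j - 1) + 1)"
    using pow by (metis of_nat_power)
  also have "[\<dots> = (-1) ^ (2 ^ (j - 1) + 1)] (mod int p)"
    using minus1 by (rule cong_pow)
  \<comment> \<open>Here \<open>j \<ge> 2\<close> enters: \<open>2 ^ (j - 1)\<close> is even, so the
    exponent is odd.\<close>
  also have "(-1 :: int) ^ (2 ^ (j - 1) + 1) = -1"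
    using k by simp
  finally have tm: "[int t ^ (2 ^ (j + 1)) = -1] (mod int p)"
    by (simp add: power_mult[symmetric])
  have p2: "p > 2"
  proof -
    have "odd (fermat j)" by (simp add: fermat_def)
    then have "p \<noteq> 2" using dvd by auto
    then show ?thesis using p prime_ge_2_nat[of p] by linarith
  qed
  have "\<not> [t ^ (2 ^ (j + 1)) = 1] (mod p)"
  proof
    assume "[t ^ (2 ^ (j + 1)) = 1] (mod p)"
    then have "[int t ^ (2 ^ (j + 1)) = 1] (mod int p)"
      by (metis cong_int_iff of_nat_1 of_nat_power)
    then have "[-1 = (1::int)] (mod int p)"
      using tm cong_sym cong_trans by blast
    then have "int p dvd 2"
      by (simp add: cong_iff_dvd_diff)
    then show False
      using p2 zdvd_imp_le by fastforce
  qed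
  then have n1: "\<not> ord p t dvd 2 ^ (j + 1)"
    unfolding ord_divides .
  have "[(int t ^ (2 ^ (j + 1))) ^ 2 = (-1) ^ 2] (mod int p)"
    using tm by (rule cong_pow)
  then have "[int (t ^ (2 ^ (j + 2))) = int 1] (mod int p)"
    by (simp add: power_mult[symmetric] mult.commute)
  then have ord1: "[t ^ (2 ^ (j + 2)) = 1] (mod p)"
    by (simp only: cong_int_iff)
  then have o: "ord p t dvd 2 ^ (j + 2)"
    by (simp only: ord_divides)
  then obtain i where i: "i \<le> j + 2" "ord p t = 2 ^ i"
    using divides_primepow_nat[OF two_is_prime_nat] by blast
  have "i = j + 2"
  proof (rule ccontr)
    assume "i \<noteq> j + 2"
    then have "i \<le> j + 1" using i by simp
    then show False using n1 i le_imp_power_dvd by metis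
  qed
  \<comment> \<open>By convention \<open>ord p t\<close> is 0 unless \<open>p\<close> and
    \<open>t\<close> are coprime; the value \<open>2 ^ i\<close> is nonzero.\<close>
  moreover have "coprime p t"
    using i by (metis ord_eq_0 power_not_zero zero_neq_numeral)
  then have "ord p t dvd p - 1"
    using order_divides_totient totient_prime[OF p] by metis
  ultimately show ?thesis
    using i by simp
qed

text \<open>Source of the factors \<open>2 ^ (j + 2) + 1\<close> in the final bound: every prime
  factor of \<open>e\<close> is already that large.\<close>

lemma fermat_divisor_ge:
  assumes "e dvd fermat j" "e > 1" "j \<ge> 2"
  shows "e \<ge> 2 ^ (j + 2) + 1"
proof -
  obtain p where p: "prime p" "p dvd e"
    using prime_factor_nat[of e] assms by auto
  then have "2 ^ (j + 2) dvd p - 1"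
    using prime_dvd_fermat_cong assms dvd_trans by blast
  then have "2 ^ (j + 2) \<le> p - 1"
    using p(1) prime_gt_1_nat[of p] by (intro dvd_imp_le) auto
  moreover have "p \<le> e"
    using p assms by (intro dvd_imp_le) auto
  ultimately show ?thesis
    using prime_gt_1_nat[OF p(1)] by linarith
qed

text \<open>Trial division up to the square root, restricted to candidates congruent to 1 modulo
  \<open>2 ^ (j + 2)\<close>. That congruence starts at \<open>j = 2\<close>, so 5 is treated
  separately.\<close>

lemma prime_fermat:
  assumes "1 \<le> j" "j \<le> 4"
  shows "prime (fermat j)"
proof (cases "j = 1")
  case True
  have "fermat 1 = 5"
    by (simp add: fermat_def)
  moreover have "prime (5::nat)"
    by simp
  ultimately show ?thesis
    using True by metis
next
  case False
  have "\<not> p ^ 2 \<le> fermat j" if p: "prime p" "p dvd fermat j" for p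
  proof
    assume small: "p ^ 2 \<le> fermat j"
    have "2 ^ (j + 2) dvd p - 1"
      using prime_dvd_fermat_cong[OF p] assms False by linarith
    then obtain k where "p - 1 = 2 ^ (j + 2) * k"
      by (elim dvdE)
    then have k: "p = 2 ^ (j + 2) * k + 1" "k \<noteq> 0"
      using prime_gt_1_nat[OF p(1)] by (linarith, cases k) auto
    have val: "fermat 2 = 17" "fermat 3 = 257" "fermat 4 = 65537"
      by (simp_all add: fermat_def)
    consider "j = 2" | "j = 3" | "j = 4"
      using assms False by linarith
    then show False
    proof cases
      case 1
      then have "17 \<le> p"
        using k by simp
      then have "17 ^ 2 \<le> p ^ 2"
        by (rule power_mono) simp
      then show False
        using small 1 val by simp
    next
      case 2
      then have "33 \<le> p"
        using k by simp
      then have "33 ^ 2 \<le> p ^ 2"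
        by (rule power_mono) simp
      then show False
        using small 2 val by simp
    next
      case 3
      \<comment> \<open>Since 257 is \<open>64 * 4 + 1\<close> and its square 66049 exceeds 65537,
        only \<open>k\<close> = 1, 2, 3 remain.\<close>
      have "p < 257"
      proof (rule ccontr)
        assume "\<not> p < 257"
        then have "257 ^ 2 \<le> p ^ 2"
          by (intro power_mono) simp_all
        then show False
          using small 3 val by simp
      qed
      then have "k < 4"
        using k(1) 3 by simp
      then have "k = 1 \<or> k = 2 \<or> k = 3"
        using k(2) by linarith
      then have "p = 65 \<or> p = 129 \<or> p = 193"
        using k(1) 3 by auto
      moreover have "\<not> 65 dvd (65537::nat)" "\<not> 129 dvd (65537::nat)" "\<not> 193 dvd (65537::nat)"
        by simp_all
      ultimately show False
        using p(2) 3 val by metis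
    qed
  qed
  moreover have "fermat j > 1"
    by (simp add: fermat_def)
  ultimately show ?thesis
    using prime_prime_factor_sqrt[of "fermat j"] by auto
qed

lemma prime_three: "prime (3::nat)"
  by simp

text \<open>As 4 is 1 modulo 3, these numbers are 2 modulo 3. This keeps the orders coprime to 3, so
  that cubing preserves them.\<close>

lemma not_three_dvd_fermat:
  assumes "j \<ge> 1"
  shows "\<not> 3 dvd fermat j"
proof -
  obtain k where k: "2 ^ j = 2 * (k::nat)"
    using assms by (cases j) auto
  have "[(2::nat) ^ (2 * k) = 1 ^ k] (mod 3)"
    unfolding power_mult by (rule cong_pow) (simp add: cong_def)
  then have "[fermat j = 1 + 1] (mod 3)"
    unfolding fermat_def k by (intro cong_add) auto
  then show ?thesis
    by (simp add: cong_def dvd_eq_mod_eq_0)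
qed

section \<open>The numerical bound and its recursion\<close>

text \<open>Merges the exact value for \<open>i \<le> 4\<close> and the lower bound for
  \<open>i \<ge> 5\<close>, so that one induction covers both.\<close>

definition order_bound :: "nat \<Rightarrow> nat" where
  "order_bound i = (\<Prod>j=1..i. if j \<le> 4 then fermat j else 2 ^ (j + 2) + 1)"

lemma order_bound_Suc:
  "order_bound (Suc i) = order_bound i * (if i < 4 then fermat (Suc i) else 2 ^ (i + 3) + 1)"
  by (simp add: order_bound_def mult.commute power_add)

lemma order_bound_le_4: "i \<le> 4 \<Longrightarrow> order_bound i = (\<Prod>j=1..i. fermat j)"
  unfolding order_bound_def by (intro prod.cong) auto

lemma order_bound_ge_5:
  assumes "i \<ge> 5"
  shows "order_bound i = (\<Prod>j=1..4. fermat j) * (\<Prod>j=5..i. 2 ^ (j + 2) + 1)"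
proof -
  have "{1..i} = {1..4} \<union> {5..i}"
    using assms by auto
  then have "order_bound i = (\<Prod>j=1..4. if j \<le> 4 then fermat j else 2 ^ (j + 2) + 1)
      * (\<Prod>j=5..i. if j \<le> 4 then fermat j else 2 ^ (j + 2) + 1)"
    unfolding order_bound_def by (simp add: prod.union_disjoint)
  also have "\<dots> = (\<Prod>j=1..4. fermat j) * (\<Prod>j=5..i. 2 ^ (j + 2) + 1)"
    by (intro arg_cong2[where f = "(*)"] prod.cong) auto
  finally show ?thesis .
qed

text \<open>For \<open>i < 4\<close> primality forces \<open>e\<close> to be the whole Fermat
  number; afterwards only \<open>fermat_divisor_ge\<close> is available and equality weakens to a
  bound.\<close>

lemma order_bound_step:
  assumes e: "e dvd fermat (Suc i)" "e > 1"
    and m: "order_bound i \<le> m" "i \<le> 4 \<Longrightarrow> m = order_bound i"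
  shows "order_bound (Suc i) \<le> m * e" "Suc i \<le> 4 \<Longrightarrow> m * e = order_bound (Suc i)"
proof -
  have small: "e = fermat (Suc i)" if "i < 4"
    using prime_fermat[of "Suc i"] e that by (auto simp: prime_nat_iff)
  have large: "2 ^ (i + 3) + 1 \<le> e" if "\<not> i < 4"
    using fermat_divisor_ge[OF e] that by (simp add: numeral_3_eq_3)
  show "Suc i \<le> 4 \<Longrightarrow> m * e = order_bound (Suc i)"
    using small m by (simp add: order_bound_Suc)
  show "order_bound (Suc i) \<le> m * e"
    unfolding order_bound_Suc using small large m by (intro mult_le_mono) auto
qed

section \<open>Arithmetic in characteristic two\<close>

context conway_tower
begin

lemma char_two_add_self:
  assumes "x \<in> carrier K"
  shows "x \<oplus> x = \<zero>"
proof -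
  have "x \<oplus> x = x \<otimes> (\<one> \<oplus> \<one>)"
    using assms by (simp add: r_distr)
  then show ?thesis
    using assms char_two by simp
qed

lemma square: "x \<in> carrier K \<Longrightarrow> x [^] (2::nat) = x \<otimes> x"
  by (simp add: numeral_2_eq_2)

lemma char_two_add_left_cancel:
  assumes "x \<in> carrier K" "y \<in> carrier K"
  shows "x \<oplus> (x \<oplus> y) = y"
  using assms by (simp add: a_assoc[symmetric] char_two_add_self)

lemma char_two_add_eq_zero_iff:
  assumes "x \<in> carrier K" "y \<in> carrier K"
  shows "x \<oplus> y = \<zero> \<longleftrightarrow> x = y"
  using assms char_two_add_left_cancel char_two_add_self by (metis r_zero)

lemma frobenius_add:
  assumes "x \<in> carrier K" "y \<in> carrier K"
  shows "(x \<oplus> y) [^] ((2::nat) ^ k) = x [^] ((2::nat) ^ k) \<oplus> y [^] ((2::nat) ^ k)"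
proof (induction k)
  case 0
  then show ?case using assms by simp
next
  case (Suc k)
  have sq: "(u \<oplus> v) [^] (2::nat) = u [^] (2::nat) \<oplus> v [^] (2::nat)"
    if "u \<in> carrier K" "v \<in> carrier K" for u v
  proof -
    have "(u \<oplus> v) [^] (2::nat) = u \<otimes> u \<oplus> (u \<otimes> v \<oplus> (u \<otimes> v \<oplus> v \<otimes> v))"
      using that by (simp add: square l_distr r_distr m_comm a_ac)
    also have "\<dots> = u \<otimes> u \<oplus> v \<otimes> v"
      using that by (simp add: char_two_add_left_cancel)
    finally show ?thesis
      using that by (simp add: square)
  qed
  have step: "z [^] ((2::nat) ^ Suc k) = (z [^] ((2::nat) ^ k)) [^] (2::nat)"
    if "z \<in> carrier K" for z
    using that by (simp add: nat_pow_pow mult.commute)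
  show ?case
    using assms by (simp add: step Suc.IH sq del: power_Suc)
qed

section \<open>Partial products, the \<open>q\<close>-power maps and norms\<close>

abbreviation q :: "nat \<Rightarrow> nat" where
  "q n \<equiv> 2 ^ (2 ^ n)"

\<comment> \<open>The shift by one makes the index a natural number: \<open>partial_prod n\<close> is the paper's \<open>a\<^sub>n\<^sub>-\<^sub>1\<close>, including \<open>a\<^sub>-\<^sub>1 = 1\<close>.\<close>
definition partial_prod :: "nat \<Rightarrow> 'a" where
  "partial_prod n = (\<Otimes>j\<in>{-1..int n - 1}. c j)"

lemma c_nat_closed [simp]: "c (int n) \<in> carrier K"
  by (simp add: c_closed)

lemma partial_prod_closed [simp]: "partial_prod n \<in> carrier K"
  unfolding partial_prod_def by (intro finprod_closed) (auto intro: c_closed)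

lemma partial_prod_0: "partial_prod 0 = \<one>"
  by (simp add: partial_prod_def c_base)

lemma partial_prod_Suc: "partial_prod (Suc n) = partial_prod n \<otimes> c (int n)"
proof -
  have "{-1..int (Suc n) - 1} = insert (int n) {-1..int n - 1}"
    by auto
  moreover have "c \<in> {-1..int n - 1} \<rightarrow> carrier K"
    by (auto intro: c_closed)
  ultimately show ?thesis
    unfolding partial_prod_def by (simp add: m_comm finprod_closed)
qed

lemma conway_a_eq_partial_prod: "conway_a K c (int n) = partial_prod (Suc n)"
proof -
  have "{-1..int (Suc n) - 1} = insert (-1) {0..int n}"
    by auto
  moreover have "c \<in> {0..int n} \<rightarrow> carrier K"
    by (auto intro: c_closed)
  ultimately show ?thesis
    unfolding partial_prod_def conway_a_def by (simp add: c_base finprod_closed)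
qed

lemma c_square: "c (int n) [^] (2::nat) \<oplus> c (int n) = partial_prod n"
  using c_step[of "int n - 1"]
  by (simp add: partial_prod_def[symmetric] char_two_add_eq_zero_iff)

lemma partial_prod_c_nonzero: "partial_prod n \<noteq> \<zero> \<and> c (int n) \<noteq> \<zero>"
proof -
  have "partial_prod n \<noteq> \<zero> \<Longrightarrow> c (int n) \<noteq> \<zero>" for n
    using c_square[of n] by (auto simp: square)
  moreover have "partial_prod n \<noteq> \<zero>" for n
  proof (induction n)
    case 0
    then show ?case by (simp add: partial_prod_0)
  next
    case (Suc n)
    then show ?case
      using calculation by (simp add: partial_prod_Suc integral_iff)
  qed
  ultimately show ?thesis by blast
qed

\<comment> \<open>Replaces the trace criterion for the irreducibility of \<open>Y\<^sup>2 + Y + a\<close>. In the step, if \<open>\<sigma>\<close> is the \<open>q n\<close>-power map and \<open>y\<close> a root at level \<open>n + 1\<close>, then \<open>\<sigma> y + y\<close> is a root at level \<open>n\<close>.\<close>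
lemma frobenius_artin_schreier:
  "partial_prod n [^] q n = partial_prod n \<and>
   (\<forall>y\<in>carrier K. y [^] (2::nat) \<oplus> y = partial_prod n \<longrightarrow> y [^] q n = y \<oplus> \<one>)"
proof (induction n)
  case 0
  show ?case
  proof (intro conjI ballI impI)
    fix y assume y: "y \<in> carrier K" "y [^] (2::nat) \<oplus> y = partial_prod 0"
    then have "y \<oplus> \<one> = y \<oplus> (y \<oplus> y [^] (2::nat))"
      by (simp add: partial_prod_0 a_comm)
    then show "y [^] q 0 = y \<oplus> \<one>"
      using y by (simp add: char_two_add_left_cancel)
  qed (simp add: partial_prod_0)
next
  case (Suc n)
  let ?\<sigma> = "\<lambda>x. x [^] q n"
  let ?a = "partial_prod n"
  \<comment> \<open>\<open>q (Suc n)\<close> is the square of \<open>q n\<close>, so the next power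
    map is the present one applied twice.\<close>
  have \<sigma>\<sigma>: "x [^] q (Suc n) = ?\<sigma> (?\<sigma> x)" if "x \<in> carrier K" for x
    using that by (simp add: nat_pow_pow power_add[symmetric] mult_2)
  have \<sigma>_add: "?\<sigma> (x \<oplus> y) = ?\<sigma> x \<oplus> ?\<sigma> y" if "x \<in> carrier K" "y \<in> carrier K" for x y
    using that by (rule frobenius_add)
  have \<sigma>_mult: "?\<sigma> (x \<otimes> y) = ?\<sigma> x \<otimes> ?\<sigma> y" if "x \<in> carrier K" "y \<in> carrier K" for x y
    using that by (rule nat_pow_distrib)
  have \<sigma>a: "?\<sigma> ?a = ?a"
    using Suc.IH by blast
  have \<sigma>c: "?\<sigma> (c (int n)) = c (int n) \<oplus> \<one>"
    using Suc.IH c_square by simp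
  have \<sigma>a': "?\<sigma> (partial_prod (Suc n)) = partial_prod (Suc n) \<oplus> ?a"
    by (simp add: partial_prod_Suc \<sigma>_mult \<sigma>a \<sigma>c r_distr)
  show ?case
  proof (intro conjI ballI impI)
    \<comment> \<open>Each application of \<open>?\<sigma>\<close> adds the fixed element
      \<open>?a\<close>; two of them cancel.\<close>
    show "partial_prod (Suc n) [^] q (Suc n) = partial_prod (Suc n)"
      by (simp add: \<sigma>\<sigma> \<sigma>a' \<sigma>_add \<sigma>a a_assoc char_two_add_self del: power_Suc)
  next
    fix y assume y: "y \<in> carrier K" "y [^] (2::nat) \<oplus> y = partial_prod (Suc n)"
    define z where "z = ?\<sigma> y \<oplus> y"
    have z: "z \<in> carrier K"
      using y by (simp add: z_def)
    have "?\<sigma> y [^] (2::nat) \<oplus> ?\<sigma> y = ?\<sigma> (y [^] (2::nat) \<oplus> y)"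
      using y(1) by (simp add: \<sigma>_add nat_pow_pow mult.commute)
    also have "\<dots> = partial_prod (Suc n) \<oplus> ?a"
      unfolding y(2) by (rule \<sigma>a')
    finally have \<sigma>y: "?\<sigma> y [^] (2::nat) \<oplus> ?\<sigma> y = partial_prod (Suc n) \<oplus> ?a" .
    have "z [^] (2::nat) = ?\<sigma> y [^] (2::nat) \<oplus> y [^] (2::nat)"
      unfolding z_def using frobenius_add[of "?\<sigma> y" y 1] y(1) by simp
    then have "z [^] (2::nat) \<oplus> z = (y [^] (2::nat) \<oplus> y) \<oplus> (?\<sigma> y [^] (2::nat) \<oplus> ?\<sigma> y)"
      using y(1) by (simp add: z_def a_ac)
    also have "\<dots> = ?a"
      unfolding \<sigma>y y(2) by (simp add: char_two_add_left_cancel)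
    finally have "?\<sigma> z = z \<oplus> \<one>"
      using Suc.IH z by blast
    then have "?\<sigma> y \<oplus> ?\<sigma> (?\<sigma> y) = ?\<sigma> y \<oplus> (y \<oplus> \<one>)"
      using y(1) by (simp add: z_def \<sigma>_add a_ac)
    then have "?\<sigma> (?\<sigma> y) = y \<oplus> \<one>"
      using y(1) by simp
    then show "y [^] q (Suc n) = y \<oplus> \<one>"
      using y(1) \<sigma>\<sigma> by simp
  qed
qed

lemma partial_prod_pow_q: "partial_prod n [^] q n = partial_prod n"
  using frobenius_artin_schreier by blast

lemma c_pow_q: "c (int n) [^] q n = c (int n) \<oplus> \<one>"
  using frobenius_artin_schreier c_square by simp

lemma pow_fermat: "x \<in> carrier K \<Longrightarrow> x [^] fermat n = x [^] q n \<otimes> x"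
  by (simp add: fermat_def)

text \<open>The conjugates \<open>c\<close> and \<open>c + 1\<close> multiply to
  \<open>c^2 + c\<close>.\<close>

lemma c_norm: "c (int n) [^] fermat n = partial_prod n"
  using c_square[of n] by (simp add: pow_fermat c_pow_q l_distr square)

text \<open>The fixed factor \<open>partial_prod n\<close> contributes its square, and the norm of
  \<open>c (int n)\<close> contributes one more copy.\<close>

lemma partial_prod_Suc_norm: "partial_prod (Suc n) [^] fermat n = partial_prod n [^] (3::nat)"
proof -
  have "partial_prod n [^] fermat n = partial_prod n [^] (2::nat)"
    by (simp add: pow_fermat partial_prod_pow_q square)
  then show ?thesis
    by (simp add: partial_prod_Suc nat_pow_distrib c_norm numeral_3_eq_3 square)
qed

section \<open>Multiplicative orders in the ambient field\<close>

lemma group_mult_of: "group (mult_of K)"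
  by (rule field_mult_group)

abbreviation mord :: "'a \<Rightarrow> nat" where
  "mord x \<equiv> group.ord (mult_of K) x"

lemma pow_pred_q:
  assumes "x \<in> carrier K" "x \<noteq> \<zero>"
  shows "x [^] (q n - 1) = \<one> \<longleftrightarrow> x [^] q n = x"
proof -
  have "x [^] q n = x [^] (q n - 1) \<otimes> x"
    using assms by (metis One_nat_def Suc_pred nat_pow_Suc zero_less_numeral zero_less_power)
  then show ?thesis
    using assms by (metis l_one m_rcancel nat_pow_closed one_closed)
qed

text \<open>Field form of \<open>ord_norm_factor\<close>: by \<open>pow_pred_q\<close>, a nonzero
  element is fixed by the \<open>q n\<close>-power map exactly when its power \<open>q n - 1\<close>
  is one.\<close>

lemma mord_factor:
  assumes x: "x \<in> carrier K" "x \<noteq> \<zero>"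
    and norm: "(x [^] fermat n) [^] q n = x [^] fermat n"
    and nonfix: "x [^] q n \<noteq> x"
  obtains e where "e > 1" "e dvd fermat n" "mord x = mord (x [^] fermat n) * e"
proof -
  interpret M: group "mult_of K" by (rule field_mult_group)
  have "x [^] fermat n \<noteq> \<zero>"
    using x M.nat_pow_closed[of x "fermat n"] by (simp add: nat_pow_mult_of)
  then have "(x [^] fermat n) [^] (q n - 1) = \<one>"
    using pow_pred_q norm x by simp
  moreover have "x [^] (q n - 1) \<noteq> \<one>"
    using pow_pred_q nonfix x by simp
  ultimately obtain e where "e > 1" "e dvd q n + 1" "mord x = mord (x [^] (q n + 1)) * e"
    using M.ord_norm_factor[of x "q n"] x by (auto simp: nat_pow_mult_of fermat_def)
  then show thesis
    using that by (simp add: fermat_def)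
qed

lemma mord_c:
  "\<exists>e>1. e dvd fermat n \<and> mord (c (int n)) = mord (partial_prod n) * e"
proof -
  have "c (int n) [^] q n \<noteq> c (int n)"
    by (simp add: c_pow_q)
  then show ?thesis
    using mord_factor[of "c (int n)" n] unfolding c_norm
    by (metis c_nat_closed partial_prod_c_nonzero partial_prod_pow_q)
qed

text \<open>The power map moves \<open>partial_prod (Suc n)\<close> by the nonzero element
  \<open>partial_prod n\<close>, while the norm is a cube of a fixed element.\<close>

lemma mord_partial_prod_Suc:
  "\<exists>e>1. e dvd fermat n \<and>
     mord (partial_prod (Suc n)) = mord (partial_prod n [^] (3::nat)) * e"
proof -
  have "partial_prod (Suc n) [^] q n = partial_prod (Suc n) \<oplus> partial_prod n"
    by (simp add: partial_prod_Suc nat_pow_distrib partial_prod_pow_q c_pow_q r_distr)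
  then have "partial_prod (Suc n) [^] q n \<noteq> partial_prod (Suc n)"
    by (simp add: partial_prod_c_nonzero)
  moreover have "(partial_prod n [^] (3::nat)) [^] q n = (partial_prod n [^] q n) [^] (3::nat)"
    by (simp add: nat_pow_pow mult.commute)
  then have "(partial_prod n [^] (3::nat)) [^] q n = partial_prod n [^] (3::nat)"
    by (simp only: partial_prod_pow_q)
  ultimately show ?thesis
    using mord_factor[of "partial_prod (Suc n)" n] unfolding partial_prod_Suc_norm
    by (metis partial_prod_closed partial_prod_c_nonzero)
qed

\<comment> \<open>The first factor is 1 because \<open>partial_prod 1 = c\<^sub>0\<close> is a cube root of unity; from then on the cube does not change the order.\<close>
lemma mord_partial_prod_step:
  "\<not> 3 dvd mord (partial_prod (Suc (Suc n))) \<and>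
   (\<exists>e>1. e dvd fermat (Suc n) \<and> mord (partial_prod (Suc (Suc n))) =
      (if n = 0 then 1 else mord (partial_prod (Suc n))) * e)"
proof (induction n)
  case 0
  interpret M: group "mult_of K" by (rule field_mult_group)
  obtain e where e: "e > 1" "e dvd fermat (Suc 0)"
    "mord (partial_prod (Suc (Suc 0))) = mord (partial_prod (Suc 0) [^] (3::nat)) * e"
    using mord_partial_prod_Suc by blast
  \<comment> \<open>\<open>fermat 0\<close> is 3, so the norm formula at level 0 is a statement
    about the cube itself.\<close>
  have "partial_prod (Suc 0) [^] (3::nat) = \<one>"
    using partial_prod_Suc_norm[of 0] by (simp add: partial_prod_0 fermat_def)
  then have "mord (partial_prod (Suc (Suc 0))) = e"
    using e M.ord_id by simp
  moreover have "\<not> 3 dvd e"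
    using e(2) not_three_dvd_fermat[of "Suc 0"] dvd_trans by auto
  ultimately show ?case
    using e by auto
next
  case (Suc n)
  interpret M: group "mult_of K" by (rule field_mult_group)
  let ?x = "partial_prod (Suc (Suc n))"
  obtain e where e: "e > 1" "e dvd fermat (Suc (Suc n))"
    "mord (partial_prod (Suc (Suc (Suc n)))) = mord (?x [^] (3::nat)) * e"
    using mord_partial_prod_Suc by blast
  have IH: "\<not> 3 dvd mord ?x"
    using Suc.IH by blast
  then have "coprime 3 (mord ?x)"
    by (intro prime_imp_coprime prime_three)
  then have "gcd (mord ?x) 3 = 1"
    by (metis coprime_imp_gcd_eq_1 gcd.commute)
  then have "mord (?x [^] (3::nat)) = mord ?x"
    using M.ord_pow_gen[of ?x 3] partial_prod_c_nonzero[of "Suc (Suc n)"]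
    by (simp add: nat_pow_mult_of)
  then have eq: "mord (partial_prod (Suc (Suc (Suc n)))) = mord ?x * e"
    using e(3) by (simp only:)
  have "\<not> 3 dvd e"
    using e(2) not_three_dvd_fermat[of "Suc (Suc n)"] dvd_trans[of 3 e] by auto
  then have "\<not> 3 dvd mord ?x * e"
    using IH prime_dvd_mult_iff[OF prime_three] by blast
  then show ?case
    unfolding eq using e(1,2) by auto
qed

section \<open>Orders in the subfields of the tower\<close>

lemma subfield_L: "subfield (L (int n)) K"
proof -
  \<comment> \<open>The shifted index lets the induction start at the prime field
    \<open>L (-1)\<close>.\<close>
  have "subfield (L (int n - 1)) K" for n
  proof (induction n)
    case 0
    have "{\<zero>, \<one>} \<union> {c (-1)} \<subseteq> carrier K"
      using c_closed by auto
    then show ?case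
      using generate_field_is_subfield by (simp add: L_base)
  next
    case (Suc n)
    have "L (int n) = generate_field K (L (int n - 1) \<union> {c (int n)})"
      using L_step[of "int n - 1"] by simp
    moreover have "L (int n - 1) \<union> {c (int n)} \<subseteq> carrier K"
      using Suc.IH by (auto dest: subfieldE(3))
    ultimately show ?case
      using generate_field_is_subfield by simp
  qed
  from this[of "Suc n"] show ?thesis
    by simp
qed

text \<open>The order depends only on which powers equal one, and a subfield shares its powers and
  its one with \<open>K\<close>. Knowing that its units form a group allows
  \<open>group.ord_def\<close> to be unfolded.\<close>

lemma mult_ord_L: "mult_ord K (L (int n)) x = mord x"
proof -
  have "group (mult_of (K\<lparr>carrier := L (int n)\<rparr>))"
    using subfield_L by (intro field.field_mult_group subfield_iff(2)) (auto dest: subfieldE(3))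
  then show ?thesis
    by (simp add: mult_ord_def group.ord_def group_mult_of nat_pow_mult_of nat_pow_consistent[symmetric])
qed

section \<open>Accumulating the factors into the bounds\<close>

lemma mord_partial_prod_bound:
  "order_bound (Suc n) \<le> mord (partial_prod (Suc (Suc n))) \<and>
   (Suc n \<le> 4 \<longrightarrow> mord (partial_prod (Suc (Suc n))) = order_bound (Suc n))"
proof (induction n)
  \<comment> \<open>The start is the empty product \<open>order_bound 0 = 1\<close>, matching the
    trivial cube of \<open>partial_prod 1\<close>.\<close>
  case 0
  obtain e where e: "e > 1" "e dvd fermat (Suc 0)" "mord (partial_prod (Suc (Suc 0))) = 1 * e"
    using mord_partial_prod_step[of 0] by auto
  then show ?case
    using order_bound_step[of e 0 1] by (simp add: order_bound_def)
next
  case (Suc n)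
  obtain e where e: "e > 1" "e dvd fermat (Suc (Suc n))"
    "mord (partial_prod (Suc (Suc (Suc n)))) = mord (partial_prod (Suc (Suc n))) * e"
    using mord_partial_prod_step[of "Suc n"] by auto
  show ?case
    unfolding e(3) using order_bound_step[OF e(2,1)] Suc.IH by blast
qed

text \<open>No induction on \<open>c\<close>: its order is one new factor times that of the
  preceding partial product. Indices start at 2 because \<open>c 1\<close> has order 15, with an
  extra factor 3 from \<open>c 0\<close>.\<close>

lemma mord_c_bound:
  "order_bound (Suc (Suc n)) \<le> mord (c (int (Suc (Suc n)))) \<and>
   (Suc (Suc n) \<le> 4 \<longrightarrow> mord (c (int (Suc (Suc n)))) = order_bound (Suc (Suc n)))"
proof -
  obtain e where e: "e > 1" "e dvd fermat (Suc (Suc n))"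
    "mord (c (int (Suc (Suc n)))) = mord (partial_prod (Suc (Suc n))) * e"
    using mord_c by blast
  show ?thesis
    unfolding e(3) using order_bound_step[OF e(2,1)] mord_partial_prod_bound[of n] by blast
qed

lemma mult_ord_bounds:
  assumes "i \<ge> 2"
  shows "order_bound i \<le> mult_ord K (L (int i)) (c (int i))"
    and "order_bound i \<le> mult_ord K (L (int i)) (conway_a K c (int i))"
    and "i \<le> 4 \<Longrightarrow> mult_ord K (L (int i)) (c (int i)) = order_bound i"
    and "i \<le> 4 \<Longrightarrow> mult_ord K (L (int i)) (conway_a K c (int i)) = order_bound i"
proof -
  obtain n where n: "i = Suc (Suc n)"
    using assms by (metis add_2_eq_Suc le_Suc_ex)
  show "order_bound i \<le> mult_ord K (L (int i)) (c (int i))"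
    "order_bound i \<le> mult_ord K (L (int i)) (conway_a K c (int i))"
    "i \<le> 4 \<Longrightarrow> mult_ord K (L (int i)) (c (int i)) = order_bound i"
    "i \<le> 4 \<Longrightarrow> mult_ord K (L (int i)) (conway_a K c (int i)) = order_bound i"
    unfolding mult_ord_L conway_a_eq_partial_prod
    using mord_c_bound[of n] mord_partial_prod_bound[of "Suc n"] unfolding n by blast+
qed

end

theorem corollary2:
  fixes K :: "('a, 'b) ring_scheme" and c :: "int \<Rightarrow> 'a" and L :: "int \<Rightarrow> 'a set"
  assumes "conway_tower K c L"
  shows "(\<forall>i::nat. 2 \<le> i \<and> i \<le> 4 \<longrightarrow>
            mult_ord K (L (int i)) (c (int i)) = (\<Prod>j=1..i. fermat j) \<and>
            mult_ord K (L (int i)) (conway_a K c (int i)) = (\<Prod>j=1..i. fermat j))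
       \<and> (\<forall>i::nat. i \<ge> 5 \<longrightarrow>
            mult_ord K (L (int i)) (c (int i))
              \<ge> (\<Prod>j=1..4. fermat j) * (\<Prod>j=5..i. 2 ^ (j + 2) + 1) \<and>
            mult_ord K (L (int i)) (conway_a K c (int i))
              \<ge> (\<Prod>j=1..4. fermat j) * (\<Prod>j=5..i. 2 ^ (j + 2) + 1))"
proof -
  interpret conway_tower K c L by fact
  show ?thesis
  proof (intro conjI allI impI)
    fix i :: nat assume "2 \<le> i \<and> i \<le> 4"
    then show "mult_ord K (L (int i)) (c (int i)) = (\<Prod>j=1..i. fermat j)"
      and "mult_ord K (L (int i)) (conway_a K c (int i)) = (\<Prod>j=1..i. fermat j)"
      using mult_ord_bounds(3,4) order_bound_le_4 by metis+
  next
    fix i :: nat assume i: "5 \<le> i"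
    then have "2 \<le> i" by simp
    then show "mult_ord K (L (int i)) (c (int i))
        \<ge> (\<Prod>j=1..4. fermat j) * (\<Prod>j=5..i. 2 ^ (j + 2) + 1)"
      and "mult_ord K (L (int i)) (conway_a K c (int i))
        \<ge> (\<Prod>j=1..4. fermat j) * (\<Prod>j=5..i. 2 ^ (j + 2) + 1)"
      unfolding order_bound_ge_5[OF i, symmetric] by (rule mult_ord_bounds)+
  qed
qed

end
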